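(* Let $(A,\mu,\alpha)$ be a multiplicative Hom-alternative algebra over $\mathbf{k}$. Then $A^+_L = (A,[,,],\alpha^2)$ is a multiplicative Hom-Lie triple system (with both twisting maps equal to $\alpha^2$), where $$[xyz] = \frac{1}{2}[[x,y],\alpha(z)] - as_A(x,y,z)$$ for $x,y,z\in A$, with $[x,y]=\mu(x,y)-\mu(y,x)$ the commutator bracket of $\mu$ and $as_A$ the Hom-associator of $A$.
   Context: $\mathbf{k}$ is a fixed field of characteristic $0$; $\alpha^k$ denotes $k$-fold composition. A multiplicative Hom-algebra $(A,\mu,\alpha)$ is a $\mathbf{k}$-module $A$ with a bilinear map $\mu\colon A\otimes A\to A$ (no associativity assumed), written $xy=\mu(x,y)$, and a linear map $\alpha\colon A\to A$ such that $\alpha(xy)=\alpha(x)\alpha(y)$. Its Hom-associator is $as_A(x,y,z) = (xy)\alpha(z) - \alpha(x)(yz)$. A Hom-alternative algebra is a Hom-algebra whose Hom-associator is anti-symmetric in its three arguments (permuting the arguments by $\sigma$ multiplies $as_A$ by the sign of $\sigma$). A Hom-Lie triple system $(L,[,,],(\alpha_1,\alpha_2))$ is a $\mathbf{k}$-module $L$ with a trilinear map $[,,]\colon L^{\otimes 3}\to L$ and linear maps $\alpha_1,\alpha_2\colon L\to L$ (the twisting maps) such that, for all $u,v,w,x,y\in L$: $[uvw]=-[vuw]$; $[uvw]+[wuv]+[vwu]=0$; and $$[\alpha_1(x)\,\alpha_2(y)\,[uvw]] = [[xyu]\,\alpha_1(v)\,\alpha_2(w)] + [\alpha_1(u)\,[xyv]\,\alpha_2(w)]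 + [\alpha_1(u)\,\alpha_2(v)\,[xyw]].$$ When $\alpha_1=\alpha_2=\gamma$ it is written $(L,[,,],\gamma)$; it is multiplicative if $\alpha_1=\alpha_2=\gamma$ and $\gamma([xyz])=[\gamma(x)\gamma(y)\gamma(z)]$ for all $x,y,z$. *)

theory Defs
  imports Complex_Main "HOL-Combinatorics.Permutations"
begin

definition hom_associator :: "('a \<Rightarrow> 'a \<Rightarrow> 'a) \<Rightarrow> ('a \<Rightarrow> 'a) \<Rightarrow> 'a \<Rightarrow> 'a \<Rightarrow> 'a \<Rightarrow> 'a::ab_group_add"
  where "hom_associator \<mu> \<alpha> x y z = \<mu> (\<mu> x y) (\<alpha> z) - \<mu> (\<alpha> x) (\<mu> y z)"

definition commutator :: "('a \<Rightarrow> 'a \<Rightarrow> 'a) \<Rightarrow> 'a \<Rightarrow> 'a \<Rightarrow> 'a::ab_group_add"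
  where "commutator \<mu> x y = \<mu> x y - \<mu> y x"

locale hom_algebra =
  vector_space scale
  for scale :: "'k::field_char_0 \<Rightarrow> 'a::ab_group_add \<Rightarrow> 'a" (infixr \<open>*s\<close> 75) +
  fixes \<mu> :: "'a \<Rightarrow> 'a \<Rightarrow> 'a" and \<alpha> :: "'a \<Rightarrow> 'a"
  assumes mult_linear_right: "\<And>x. Vector_Spaces.linear scale scale (\<lambda>y. \<mu> x y)"
    and mult_linear_left: "\<And>y. Vector_Spaces.linear scale scale (\<lambda>x. \<mu> x y)"
    and twist_linear: "Vector_Spaces.linear scale scale \<alpha>"

locale multiplicative_hom_algebra = hom_algebra +
  assumes twist_mult: "\<alpha> (\<mu> x y) = \<mu> (\<alpha> x) (\<alpha> y)"

text \<open>The three arguments of the Hom-associator are collected in a family indexed by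
  \<open>0, 1, 2\<close>, which a permutation reorders.\<close>

locale hom_alternative_algebra = hom_algebra +
  assumes hom_associator_antisymmetric:
    "\<And>\<sigma> v. \<sigma> permutes {0, 1, 2 :: nat} \<Longrightarrow>
       hom_associator \<mu> \<alpha> (v (\<sigma> 0)) (v (\<sigma> 1)) (v (\<sigma> 2)) =
         of_int (sign \<sigma>) *s hom_associator \<mu> \<alpha> (v 0) (v 1) (v 2)"

locale hom_lie_triple_system =
  vector_space scale
  for scale :: "'k::field_char_0 \<Rightarrow> 'a::ab_group_add \<Rightarrow> 'a" (infixr \<open>*s\<close> 75) +
  fixes T :: "'a \<Rightarrow> 'a \<Rightarrow> 'a \<Rightarrow> 'a" and \<alpha>\<^sub>1 \<alpha>\<^sub>2 :: "'a \<Rightarrow> 'a"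
  assumes triple_linear_1: "\<And>y z. Vector_Spaces.linear scale scale (\<lambda>x. T x y z)"
    and triple_linear_2: "\<And>x z. Vector_Spaces.linear scale scale (\<lambda>y. T x y z)"
    and triple_linear_3: "\<And>x y. Vector_Spaces.linear scale scale (\<lambda>z. T x y z)"
    and twist_1_linear: "Vector_Spaces.linear scale scale \<alpha>\<^sub>1"
    and twist_2_linear: "Vector_Spaces.linear scale scale \<alpha>\<^sub>2"
    and triple_skew: "T u v w = - T v u w"
    and triple_cyclic: "T u v w + T w u v + T v w u = 0"
    and hom_nambu_identity:
      "T (\<alpha>\<^sub>1 x) (\<alpha>\<^sub>2 y) (T u v w) =
         T (T x y u) (\<alpha>\<^sub>1 v) (\<alpha>\<^sub>2 w) + T (\<alpha>\<^sub>1 u) (T x y v) (\<alpha>\<^sub>2 w) + T (\<alpha>\<^sub>1 u) (\<alpha>\<^sub>2 v) (T x y w)"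

locale multiplicative_hom_lie_triple_system = hom_lie_triple_system +
  assumes twists_eq: "\<alpha>\<^sub>1 = \<alpha>\<^sub>2"
    and twist_triple: "\<alpha>\<^sub>1 (T x y z) = T (\<alpha>\<^sub>1 x) (\<alpha>\<^sub>1 y) (\<alpha>\<^sub>1 z)"

definition alternative_triple ::
    "('k::field_char_0 \<Rightarrow> 'a \<Rightarrow> 'a) \<Rightarrow> ('a \<Rightarrow> 'a \<Rightarrow> 'a) \<Rightarrow> ('a \<Rightarrow> 'a) \<Rightarrow> 'a \<Rightarrow> 'a \<Rightarrow> 'a \<Rightarrow> 'a::ab_group_add"
  where "alternative_triple scale \<mu> \<alpha> x y z =
    scale (1 / 2) (commutator \<mu> (commutator \<mu> x y) (\<alpha> z)) - hom_associator \<mu> \<alpha> x y z"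

end

theory Submission
  imports Defs
begin

text \<open>
  For an honest alternative algebra the triple product is a disguised inner derivation: writing
  \<open>x \<bullet> y = xy + yx\<close> one finds
  \<open>2[xyz] = x \<bullet> (y \<bullet> z) - y \<bullet> (x \<bullet> z)\<close>, and \<open>\<bullet>\<close> is a Jordan product, for which commutators of
  multiplication operators are derivations. A triple product \<open>[xyz] = D\<^sub>x\<^sub>,\<^sub>y z\<close> built
  from an operation of which the \<open>D\<^sub>x\<^sub>,\<^sub>y\<close> are derivations automatically satisfies the Nambu
  identity. The same plan works with twists.

  Hom-alternativity gives the Hom-Jordan identity for \<open>\<bullet>\<close> (\<open>anticommutator_jordan\<close>): the
  Hom-associator vanishes on \<open>(x\<^sup>2, \<alpha> y, \<alpha> x)\<close> by the Teichmueller identity, and what is left of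
  the Jordan associator vanishes by left and right alternativity.

  The fully polarized Jordan identity has a right-hand side symmetric in all four variables, whereas the left-hand side singles out
  one of them; comparing two choices of the singled-out variable is exactly the statement that
  \<open>D\<close> acts as an \<open>\<alpha>\<^sup>2\<close>-twisted derivation (\<open>derivation_of_product\<close>). Applying this twice, to the
  outer and to the inner product in \<open>\<alpha> u \<bullet> (v \<bullet> w)\<close>, yields the Hom-Nambu identity. Each
  application removes one \<open>\<alpha>\<close> from \<open>x\<close> and \<open>y\<close> in \<open>D\<^sub>x\<^sub>,\<^sub>y\<close>, which is why the triple
  system is twisted by \<open>\<alpha>\<^sup>2\<close> rather than \<open>\<alpha>\<close>.
\<close>

section \<open>Additivity of the structure maps\<close>

lemma linear_imp_additive:
  assumes "Vector_Spaces.linear s1 s2 f"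
  shows "f (x + y) = f x + f y" "f (x - y) = f x - f y" "f (- x) = - f x"
    "f 0 = 0" "f (s1 c x) = s2 c (f x)"
proof -
  interpret Vector_Spaces.linear s1 s2 f by (rule assms)
  show "f (x + y) = f x + f y" "f (x - y) = f x - f y" "f (- x) = - f x"
    "f 0 = 0" "f (s1 c x) = s2 c (f x)"
    by (simp_all add: add diff neg scale)
qed

context hom_algebra
begin

lemmas mult_right = linear_imp_additive[OF mult_linear_right]
lemmas mult_left = linear_imp_additive[OF mult_linear_left]
lemmas twist_additive = linear_imp_additive[OF twist_linear]
lemmas additivity = mult_right mult_left twist_additive

lemma linearI:
  assumes "\<And>x y. f (x + y) = f x + f y" "\<And>c x. f (c *s x) = c *s f x"
  shows "Vector_Spaces.linear scale scale f"
  using assms by unfold_locales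

lemma two_torsion_free:
  fixes x :: 'a
  assumes "x + x = 0"
  shows "x = 0"
proof -
  have "2 *s x = x + x"
    using scale_left_distrib[of 1 1 x] by simp
  with assms show ?thesis by simp
qed

end

text \<open>Only a cyclic sum appears because the form is already symmetric in two arguments, so each
  cyclic term is met twice among the six permutations. The sum is left doubled because the
  target may have 2-torsion.\<close>

lemma polarize_cubic:
  fixes Q :: "'a::ab_group_add \<Rightarrow> 'a \<Rightarrow> 'a \<Rightarrow> 'b::ab_group_add"
  assumes add: "\<And>a b c d. Q (a + b) c d = Q a c d + Q b c d"
      "\<And>a b c d. Q c (a + b) d = Q c a d + Q c b d"
      "\<And>a b c d. Q c d (a + b) = Q c d a + Q c d b"
    and sym: "\<And>a b c. Q a b c = Q b a c"
    and cubic: "\<And>a. Q a a a = 0"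
  defines "S \<equiv> \<lambda>x z w. Q x z w + Q z w x + Q w x z"
  shows "S x z w + S x z w = 0"
proof -
  \<comment> \<open>the mixed part of the cubic form on \<open>a + b\<close>; inclusion-exclusion then isolates the terms
    containing all three variables\<close>
  define P where "P a b = Q a a b + Q a b a + Q b a a + Q a b b + Q b a b + Q b b a" for a b
  have P: "P a b = 0" for a b
  proof -
    have "P a b = Q (a + b) (a + b) (a + b) - Q a a a - Q b b b"
      unfolding P_def add by (simp add: algebra_simps)
    then show ?thesis by (simp only: cubic diff_self)
  qed
  have "Q x z w + Q x w z + Q z x w + Q z w x + Q w x z + Q w z x =
      Q (x + z + w) (x + z + w) (x + z + w) - P x z - P x w - P z w - Q x x x - Q z z z - Q w w w"
    unfolding P_def add by (simp add: algebra_simps)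
  then have "Q x z w + Q x w z + Q z x w + Q z w x + Q w x z + Q w z x = 0"
    by (simp only: P cubic diff_self)
  then show ?thesis
    unfolding S_def using sym[of w z x] sym[of x w z] sym[of z x w] by (simp add: algebra_simps)
qed

section \<open>Hom-Jordan algebras and their inner derivations\<close>

locale hom_jordan_algebra = multiplicative_hom_algebra +
  assumes commute: "\<mu> x y = \<mu> y x"
    and jordan: "\<mu> (\<mu> (\<mu> x x) (\<alpha> y)) (\<alpha> (\<alpha> x)) = \<mu> (\<alpha> (\<mu> x x)) (\<mu> (\<alpha> y) (\<alpha> x))"
begin

lemma jordan_polarized:
  "\<mu> (\<mu> (\<mu> x z) (\<alpha> y)) (\<alpha> (\<alpha> w)) + \<mu> (\<mu> (\<mu> z w) (\<alpha> y)) (\<alpha> (\<alpha> x))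
     + \<mu> (\<mu> (\<mu> w x) (\<alpha> y)) (\<alpha> (\<alpha> z))
   = \<mu> (\<alpha> (\<mu> x z)) (\<alpha> (\<mu> y w)) + \<mu> (\<alpha> (\<mu> z w)) (\<alpha> (\<mu> y x))
     + \<mu> (\<alpha> (\<mu> w x)) (\<alpha> (\<mu> y z))"
proof -
  let ?Q = "\<lambda>x z w. \<mu> (\<mu> (\<mu> x z) (\<alpha> y)) (\<alpha> (\<alpha> w)) - \<mu> (\<alpha> (\<mu> x z)) (\<alpha> (\<mu> y w))"
  let ?S = "?Q x z w + ?Q z w x + ?Q w x z"
  have "?S + ?S = 0"
  proof (rule polarize_cubic[where Q = ?Q])
    show "?Q a b c = ?Q b a c" for a b c by (simp add: commute[of a b])
    show "?Q a a a = 0" for a using jordan[of a y] by (simp add: twist_mult)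
  qed (simp_all add: additivity)
  then have "?S = 0" by (rule two_torsion_free)
  then show ?thesis by (simp add: algebra_simps)
qed

definition inner_derivation :: "'b \<Rightarrow> 'b \<Rightarrow> 'b \<Rightarrow> 'b"
  where "inner_derivation x y z = \<mu> (\<alpha> x) (\<mu> y z) - \<mu> (\<alpha> y) (\<mu> x z)"

text \<open>The right-hand side of \<open>jordan_polarized\<close> runs over the three ways to split
  \<open>{x, y, z, w}\<close> into pairs, so it does not change when \<open>x\<close> and \<open>y\<close> are exchanged. The resulting
  change of the left-hand side is the asserted identity.\<close>

lemma derivation_of_product:
  "inner_derivation (\<alpha> x) (\<alpha> y) (\<mu> z w) =
     \<mu> (inner_derivation x y z) (\<alpha> (\<alpha> w)) + \<mu> (\<alpha> (\<alpha> z)) (inner_derivation x y w)"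
proof -
  have "\<mu> (\<mu> (\<mu> x z) (\<alpha> y)) (\<alpha> (\<alpha> w)) + \<mu> (\<mu> (\<mu> z w) (\<alpha> y)) (\<alpha> (\<alpha> x))
          + \<mu> (\<mu> (\<mu> w x) (\<alpha> y)) (\<alpha> (\<alpha> z))
      = \<mu> (\<mu> (\<mu> y z) (\<alpha> x)) (\<alpha> (\<alpha> w)) + \<mu> (\<mu> (\<mu> z w) (\<alpha> x)) (\<alpha> (\<alpha> y))
          + \<mu> (\<mu> (\<mu> w y) (\<alpha> x)) (\<alpha> (\<alpha> z))"
    unfolding jordan_polarized by (simp add: commute ac_simps)
  then show ?thesis
    unfolding inner_derivation_def
    by (simp add: additivity commute algebra_simps)
qed

lemma twist_inner_derivation:
  "\<alpha> (inner_derivation x y z) = inner_derivation (\<alpha> x) (\<alpha> y) (\<alpha> z)"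
  by (simp add: inner_derivation_def additivity twist_mult)

text \<open>Each of the two summands of \<open>inner_derivation u v w\<close> is a nested product, to which the
  product rule applies twice; the six resulting terms regroup according to which of
  \<open>u\<close>, \<open>v\<close>, \<open>w\<close> was differentiated.\<close>

lemma inner_derivation_nambu:
  "inner_derivation (\<alpha> (\<alpha> x)) (\<alpha> (\<alpha> y)) (inner_derivation u v w) =
     inner_derivation (inner_derivation x y u) (\<alpha> (\<alpha> v)) (\<alpha> (\<alpha> w))
     + inner_derivation (\<alpha> (\<alpha> u)) (inner_derivation x y v) (\<alpha> (\<alpha> w))
     + inner_derivation (\<alpha> (\<alpha> u)) (\<alpha> (\<alpha> v)) (inner_derivation x y w)"
proof -
  let ?D = inner_derivation
  have summand: "?D (\<alpha> (\<alpha> x)) (\<alpha> (\<alpha> y)) (\<mu> (\<alpha> a) (\<mu> b c)) =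
      \<mu> (\<alpha> (?D x y a)) (\<mu> (\<alpha> (\<alpha> b)) (\<alpha> (\<alpha> c)))
      + \<mu> (\<alpha> (\<alpha> (\<alpha> a))) (\<mu> (?D x y b) (\<alpha> (\<alpha> c)))
      + \<mu> (\<alpha> (\<alpha> (\<alpha> a))) (\<mu> (\<alpha> (\<alpha> b)) (?D x y c))" for a b c
    by (simp add: derivation_of_product twist_inner_derivation twist_mult additivity)
  have diff: "?D a b (c - d) = ?D a b c - ?D a b d" for a b c d
    by (simp add: inner_derivation_def additivity)
  show ?thesis
    unfolding inner_derivation_def[of u v w] diff summand
    unfolding inner_derivation_def[of _ _ "\<alpha> (\<alpha> w)"] inner_derivation_def[of _ _ "?D x y w"]
    by (simp add: algebra_simps)
qed

theorem inner_derivation_triple_system: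
  "multiplicative_hom_lie_triple_system scale (\<lambda>x y z. c *s inner_derivation x y z)
     (\<alpha> ^^ 2) (\<alpha> ^^ 2)"
proof -
  let ?D = inner_derivation
  let ?T = "\<lambda>x y z. c *s ?D x y z"
  have sq: "(\<alpha> ^^ 2) a = \<alpha> (\<alpha> a)" for a by (simp add: numeral_2_eq_2)
  have scale_D: "?D (k *s u) v w = k *s ?D u v w" "?D u (k *s v) w = k *s ?D u v w"
    "?D u v (k *s w) = k *s ?D u v w" for k u v w
    by (simp_all add: inner_derivation_def additivity scale_right_diff_distrib)
  have add_D: "?D (a + b) v w = ?D a v w + ?D b v w" "?D v (a + b) w = ?D v a w + ?D v b w"
    "?D v w (a + b) = ?D v w a + ?D v w b" for a b v w
    by (simp_all add: inner_derivation_def additivity)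
  have linear_square: "Vector_Spaces.linear scale scale (\<alpha> ^^ 2)"
    by (rule linearI) (simp_all add: sq additivity)
  show ?thesis
  proof (intro multiplicative_hom_lie_triple_system.intro hom_lie_triple_system.intro
      hom_lie_triple_system_axioms.intro multiplicative_hom_lie_triple_system_axioms.intro)
    fix x y z u v w
    show "Vector_Spaces.linear scale scale (\<lambda>x. ?T x y z)"
      "Vector_Spaces.linear scale scale (\<lambda>y. ?T x y z)"
      "Vector_Spaces.linear scale scale (\<lambda>z. ?T x y z)"
      by (rule linearI; simp add: add_D scale_D scale_right_distrib mult.commute)+
    show "?T u v w = - ?T v u w"
      by (simp add: inner_derivation_def algebra_simps)
    show "?T u v w + ?T w u v + ?T v w u = 0"
      by (simp add: inner_derivation_def commute algebra_simps)
    show "?T ((\<alpha> ^^ 2) x) ((\<alpha> ^^ 2) y) (?T u v w) =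
        ?T (?T x y u) ((\<alpha> ^^ 2) v) ((\<alpha> ^^ 2) w) + ?T ((\<alpha> ^^ 2) u) (?T x y v) ((\<alpha> ^^ 2) w)
        + ?T ((\<alpha> ^^ 2) u) ((\<alpha> ^^ 2) v) (?T x y w)"
      using inner_derivation_nambu[of x y u v w] by (simp only: sq scale_D scale_right_distrib)
    show "(\<alpha> ^^ 2) (?T x y z) = ?T ((\<alpha> ^^ 2) x) ((\<alpha> ^^ 2) y) ((\<alpha> ^^ 2) z)"
      by (simp add: sq additivity twist_inner_derivation)
  qed (use vector_space_axioms linear_square in simp_all)
qed

end

section \<open>The Jordan product of a Hom-alternative algebra\<close>

context hom_alternative_algebra
begin

lemma hom_associator_swap_12:
  "hom_associator \<mu> \<alpha> y x z = - hom_associator \<mu> \<alpha> x y z"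
  using hom_associator_antisymmetric[of "transpose 0 1" "\<lambda>i. if i = 0 then x else if i = 1 then y else z"]
  by (simp add: permutes_swap_id sign_swap_id)

lemma hom_associator_swap_23:
  "hom_associator \<mu> \<alpha> x z y = - hom_associator \<mu> \<alpha> x y z"
  using hom_associator_antisymmetric[of "transpose 1 2" "\<lambda>i. if i = 0 then x else if i = 1 then y else z"]
  by (simp add: permutes_swap_id sign_swap_id)

lemma hom_associator_swap_13:
  "hom_associator \<mu> \<alpha> z y x = - hom_associator \<mu> \<alpha> x y z"
  by (metis hom_associator_swap_12 hom_associator_swap_23)

lemma hom_associator_repeated:
  "hom_associator \<mu> \<alpha> x x y = 0" "hom_associator \<mu> \<alpha> y x x = 0" "hom_associator \<mu> \<alpha> x y x = 0"
  using hom_associator_swap_12[of x x y] hom_associator_swap_23[of y x x]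
    hom_associator_swap_13[of x y x]
  by (auto intro: two_torsion_free simp: eq_neg_iff_add_eq_0)

lemma left_alternative: "\<mu> (\<mu> x x) (\<alpha> y) = \<mu> (\<alpha> x) (\<mu> x y)"
  and right_alternative: "\<mu> (\<mu> y x) (\<alpha> x) = \<mu> (\<alpha> y) (\<mu> x x)"
  using hom_associator_repeated(1)[of x y] hom_associator_repeated(2)[of y x]
  by (simp_all add: hom_associator_def)

end

locale multiplicative_hom_alternative_algebra =
  multiplicative_hom_algebra + hom_alternative_algebra
begin

text \<open>With \<open>w = x\<close> and \<open>z = x\<close> in the Teichmueller identity
  \<open>as(wx, \<alpha> y, \<alpha> z) - as(\<alpha> w, xy, \<alpha> z) + as(\<alpha> w, \<alpha> x, yz)
   = \<alpha>\<^sup>2(w) as(x, y, z) + as(w, x, y) \<alpha>\<^sup>2(z)\<close>,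
  which holds in every multiplicative Hom-algebra, all terms but the first have a repeated
  argument.\<close>

lemma hom_associator_square: "hom_associator \<mu> \<alpha> (\<mu> x x) (\<alpha> y) (\<alpha> x) = 0"
proof -
  have "hom_associator \<mu> \<alpha> (\<mu> x x) (\<alpha> y) (\<alpha> x)
      - hom_associator \<mu> \<alpha> (\<alpha> x) (\<mu> x y) (\<alpha> x) + hom_associator \<mu> \<alpha> (\<alpha> x) (\<alpha> x) (\<mu> y x)
    = \<mu> (\<alpha> (\<alpha> x)) (hom_associator \<mu> \<alpha> x y x) + \<mu> (hom_associator \<mu> \<alpha> x x y) (\<alpha> (\<alpha> x))"
    by (simp add: hom_associator_def additivity twist_mult)
  then show ?thesis by (simp add: hom_associator_repeated additivity)
qed

text \<open>The factor \<open>1 / 2\<close> of the customary Jordan product is left out: it only rescales the inner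
  derivations, and the Jordan identity is homogeneous.\<close>

definition anticommutator :: "'b \<Rightarrow> 'b \<Rightarrow> 'b"
  where "anticommutator x y = \<mu> x y + \<mu> y x"

lemma anticommutator_jordan:
  "anticommutator (anticommutator (anticommutator x x) (\<alpha> y)) (\<alpha> (\<alpha> x)) =
     anticommutator (\<alpha> (anticommutator x x)) (anticommutator (\<alpha> y) (\<alpha> x))"
proof -
  have outer: "\<mu> (\<mu> (\<mu> x x) (\<alpha> y)) (\<alpha> (\<alpha> x)) = \<mu> (\<mu> (\<alpha> x) (\<alpha> x)) (\<mu> (\<alpha> y) (\<alpha> x))"
    using hom_associator_square[of x y] by (simp add: hom_associator_def twist_mult)
  have "hom_associator \<mu> \<alpha> (\<alpha> x) (\<alpha> y) (\<mu> x x) = 0"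
    using hom_associator_square[of x y] hom_associator_swap_13[of "\<alpha> x" "\<alpha> y" "\<mu> x x"]
    by simp
  then have outer': "\<mu> (\<alpha> (\<alpha> x)) (\<mu> (\<alpha> y) (\<mu> x x)) = \<mu> (\<mu> (\<alpha> x) (\<alpha> y)) (\<mu> (\<alpha> x) (\<alpha> x))"
    by (simp add: hom_associator_def twist_mult)
  have left: "\<mu> (\<alpha> (\<alpha> x)) (\<mu> (\<mu> x x) (\<alpha> y)) = \<mu> (\<mu> (\<alpha> x) (\<alpha> x)) (\<mu> (\<alpha> x) (\<alpha> y))"
    using left_alternative[of x y] left_alternative[of "\<alpha> x" "\<mu> x y"] by (simp add: twist_mult)
  have right: "\<mu> (\<mu> (\<alpha> y) (\<mu> x x)) (\<alpha> (\<alpha> x)) = \<mu> (\<mu> (\<alpha> y) (\<alpha> x)) (\<mu> (\<alpha> x) (\<alpha> x))"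
    using right_alternative[of y x] right_alternative[of "\<mu> y x" "\<alpha> x"] by (simp add: twist_mult)
  show ?thesis
    by (simp add: anticommutator_def additivity twist_mult outer outer' left right algebra_simps)
qed

sublocale jordan: hom_jordan_algebra scale anticommutator \<alpha>
proof (intro hom_jordan_algebra.intro multiplicative_hom_algebra.intro hom_algebra.intro
    hom_algebra_axioms.intro multiplicative_hom_algebra_axioms.intro hom_jordan_algebra_axioms.intro)
  show "Vector_Spaces.linear scale scale (\<lambda>y. anticommutator x y)"
    "Vector_Spaces.linear scale scale (\<lambda>y. anticommutator y x)" for x
    by (rule linearI; simp add: anticommutator_def additivity scale_right_distrib ac_simps)+
  show "anticommutator x y = anticommutator y x" for x y
    by (simp add: anticommutator_def add.commute)
  show "\<alpha> (anticommutator x y) = anticommutator (\<alpha> x) (\<alpha> y)" for x y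
    by (simp add: anticommutator_def additivity twist_mult)
qed (fact vector_space_axioms twist_linear anticommutator_jordan)+

text \<open>Suppressing twists, rebracketing the expansion of
  \<open>x \<bullet> (y \<bullet> z) - y \<bullet> (x \<bullet> z)\<close> to that of \<open>[[x, y], z]\<close> costs six associators,
  all equal up to sign, that sum to \<open>-2 as(x, y, z)\<close>.\<close>

lemma inner_derivation_conv_commutator:
  "jordan.inner_derivation x y z =
     commutator \<mu> (commutator \<mu> x y) (\<alpha> z) - (hom_associator \<mu> \<alpha> x y z + hom_associator \<mu> \<alpha> x y z)"
proof -
  let ?as = "hom_associator \<mu> \<alpha>"
  have rebracket: "\<mu> (\<mu> a b) (\<alpha> c) = ?as a b c + \<mu> (\<alpha> a) (\<mu> b c)" for a b c
    by (simp add: hom_associator_def)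
  have signs: "?as y x z = - ?as x y z" "?as x z y = - ?as x y z" "?as z y x = - ?as x y z"
    "?as y z x = ?as x y z" "?as z x y = ?as x y z"
    by (metis hom_associator_swap_12 hom_associator_swap_23 minus_minus)+
  show ?thesis
    unfolding jordan.inner_derivation_def anticommutator_def commutator_def
    by (simp add: additivity rebracket signs algebra_simps)
qed

lemma alternative_triple_conv_inner_derivation:
  "alternative_triple scale \<mu> \<alpha> x y z = (1 / 2) *s jordan.inner_derivation x y z"
proof -
  have "(1 / 2) *s (a + a) = a" for a
    using scale_left_distrib[of "1 / 2" "1 / 2" a] by (simp add: scale_right_distrib)
  then show ?thesis
    by (simp add: alternative_triple_def inner_derivation_conv_commutator scale_right_diff_distrib)
qed

end

theorem corollary4p6:
  fixes scale :: "'k::field_char_0 \<Rightarrow> 'a::ab_group_add \<Rightarrow> 'a"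
    and \<mu> :: "'a \<Rightarrow> 'a \<Rightarrow> 'a" and \<alpha> :: "'a \<Rightarrow> 'a"
  assumes "multiplicative_hom_algebra scale \<mu> \<alpha>"
    and "hom_alternative_algebra scale \<mu> \<alpha>"
  shows "multiplicative_hom_lie_triple_system scale (alternative_triple scale \<mu> \<alpha>)
           (\<alpha> ^^ 2) (\<alpha> ^^ 2)"
proof -
  interpret multiplicative_hom_alternative_algebra scale \<mu> \<alpha>
    using assms by (simp add: multiplicative_hom_alternative_algebra_def)
  have "alternative_triple scale \<mu> \<alpha> = (\<lambda>x y z. scale (1 / 2) (jordan.inner_derivation x y z))"
    by (intro ext) (rule alternative_triple_conv_inner_derivation)
  then show ?thesis
    by (simp only: jordan.inner_derivation_triple_system)
qed

end
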